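(* For every integer $n\ge 0$, the characteristic polynomial of the adjacency matrix of $\tilde R_n$ is $$\phi(A(\tilde R_n),x) = \bigl(x^3-(n+1)x^2-(n+3)x+(3n+2)\bigr)(x+1)^n(x^2+x-1).$$
   Context: For a simple graph $\Gamma$, $A(\Gamma)$ denotes its adjacency matrix, and $\phi(A,x)=\det(xI-A)$ denotes the characteristic polynomial of a square matrix $A$. Duplicating a vertex $v'$ of a graph $G$ means adding a new vertex $v$ to $G$ together with the edge $vv'$ and all edges $vx$ with $xv'\in E(G)$. For $n\ge 0$, $\tilde R_n$ denotes the graph on $n+5$ vertices (unique up to isomorphism) obtained from the 5-cycle $C_5$ by duplicating one and the same vertex of the 5-cycle $n$ times; in particular $\tilde R_0=C_5$. *)

theory Defs
  imports "Graph_Theory.Pair_Digraph" "Jordan_Normal_Form.Char_Poly"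
begin

text \<open>
  A finite simple graph is a \<^locale>\<open>pair_graph\<close>: a finite vertex set together with
  a symmetric irreflexive arc set, each undirected edge \<open>uv\<close> being represented by the two arcs
  \<open>(u, v)\<close> and \<open>(v, u)\<close>.
\<close>

definition cycle_graph :: "nat \<Rightarrow> 'a pair_pre_digraph \<Rightarrow> bool" where
  "cycle_graph k G \<longleftrightarrow> k \<ge> 3 \<and>
     (\<exists>vs. length vs = k \<and> distinct vs \<and> pverts G = set vs \<and>
        parcs G = (\<Union>i<k. {(vs ! i, vs ! ((i + 1) mod k)), (vs ! ((i + 1) mod k), vs ! i)}))"

text \<open>\<open>duplicate_vertex G v' v\<close> adds the new vertex \<open>v\<close> as a duplicate of the vertex \<open>v'\<close>
  of \<open>G\<close>. It is meant for \<open>v' \<in> pverts G\<close> and \<open>v \<notin> pverts G\<close>.\<close>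

definition duplicate_vertex :: "'a pair_pre_digraph \<Rightarrow> 'a \<Rightarrow> 'a \<Rightarrow> 'a pair_pre_digraph" where
  "duplicate_vertex G v' v =
     \<lparr> pverts = insert v (pverts G),
       parcs = parcs G \<union> {(v, v'), (v', v)}
         \<union> {(v, x) | x. (x, v') \<in> parcs G} \<union> {(x, v) | x. (x, v') \<in> parcs G} \<rparr>"

inductive duplicated_times ::
    "'a pair_pre_digraph \<Rightarrow> 'a \<Rightarrow> nat \<Rightarrow> 'a pair_pre_digraph \<Rightarrow> bool" for G v' where
  zero: "duplicated_times G v' 0 G"
| Suc: "duplicated_times G v' n H \<Longrightarrow> v \<notin> pverts H \<Longrightarrow>
    duplicated_times G v' (Suc n) (duplicate_vertex H v' v)"

text \<open>\<open>is_Rtilde n G\<close> says that \<open>G\<close> is a copy of the graph \<open>R\<close>-tilde-\<open>n\<close>. This graph is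
  determined only up to isomorphism, so the 5-cycle, its duplicated vertex and the labels of the
  new vertices are all left arbitrary.\<close>

definition is_Rtilde :: "nat \<Rightarrow> 'a pair_pre_digraph \<Rightarrow> bool" where
  "is_Rtilde n G \<longleftrightarrow> (\<exists>C v'. cycle_graph 5 C \<and> v' \<in> pverts C \<and> duplicated_times C v' n G)"

text \<open>The rows and columns of the adjacency matrix are indexed by an enumeration \<open>vs\<close> of the
  vertices without repetitions.\<close>

definition adjacency_matrix :: "'a pair_pre_digraph \<Rightarrow> 'a list \<Rightarrow> 'b :: {zero,one} mat" where
  "adjacency_matrix G vs =
     mat (length vs) (length vs) (\<lambda>(i, j). if (vs ! i, vs ! j) \<in> parcs G then 1 else 0)"

text \<open>Copies of all these graphs exist, and they are simple graphs on \<open>n + 5\<close> vertices.\<close>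

lemma pair_graph_iff:
  "pair_graph G \<longleftrightarrow> finite (pverts G) \<and> parcs G \<subseteq> pverts G \<times> pverts G \<and> sym (parcs G) \<and> irrefl (parcs G)"
proof
  assume "pair_graph G"
  then interpret pair_graph G .
  show "finite (pverts G) \<and> parcs G \<subseteq> pverts G \<times> pverts G \<and> sym (parcs G) \<and> irrefl (parcs G)"
    using pair_finite_verts pair_sym_arcs pair_no_loops in_arcsD1 in_arcsD2
    by (fastforce simp: symmetric_def irrefl_def)
next
  assume *: "finite (pverts G) \<and> parcs G \<subseteq> pverts G \<times> pverts G \<and> sym (parcs G) \<and> irrefl (parcs G)"
  then have "finite (parcs G)" by (auto intro: finite_subset)
  with * show "pair_graph G"
    by unfold_locales (auto simp: symmetric_def irrefl_def)
qed

lemma cycle_graph_pair_graph: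
  assumes "cycle_graph k G"
  shows "pair_graph G" "card (pverts G) = k"
proof -
  from assms obtain vs where k: "k \<ge> 3" and vs: "length vs = k" "distinct vs" "pverts G = set vs"
    and arcs: "parcs G = (\<Union>i<k. {(vs ! i, vs ! ((i + 1) mod k)), (vs ! ((i + 1) mod k), vs ! i)})"
    by (auto simp: cycle_graph_def)
  have ne: "vs ! i \<noteq> vs ! ((i + 1) mod k)" if "i < k" for i
  proof -
    have "(i + 1) mod k \<noteq> i" using that k
      by (cases "i + 1 = k") auto
    moreover have "(i + 1) mod k < k" using k by simp
    ultimately show ?thesis using vs that by (simp add: nth_eq_iff_index_eq)
  qed
  have "sym (parcs G)" unfolding arcs by (rule symI) blast
  moreover have "irrefl (parcs G)"
    unfolding arcs by (rule irreflI) (use ne in force)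
  moreover have "vs ! i \<in> pverts G" "vs ! ((i + 1) mod k) \<in> pverts G" if "i < k" for i
    using vs k that by simp_all
  then have "parcs G \<subseteq> pverts G \<times> pverts G" unfolding arcs by blast
  ultimately show "pair_graph G" using vs by (simp add: pair_graph_iff)
  show "card (pverts G) = k" using vs by (simp add: distinct_card)
qed

lemma duplicate_vertex_pair_graph:
  assumes "pair_graph G" "v' \<in> pverts G" "v \<notin> pverts G"
  shows "pair_graph (duplicate_vertex G v' v)"
  using assms unfolding pair_graph_iff duplicate_vertex_def sym_def irrefl_def
  by auto

lemma duplicated_times_pair_graph:
  assumes "duplicated_times G v' n H" "pair_graph G" "v' \<in> pverts G"
  shows "pair_graph H \<and> v' \<in> pverts H \<and> card (pverts H) = card (pverts G) + n"
  using assms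
proof (induction rule: duplicated_times.induct)
  case zero
  then show ?case by simp
next
  case (Suc n H v)
  then have H: "pair_graph H" "v' \<in> pverts H" "card (pverts H) = card (pverts G) + n" by auto
  then have "finite (pverts H)" by (simp add: pair_graph_iff)
  moreover have "pverts (duplicate_vertex H v' v) = insert v (pverts H)"
    by (simp add: duplicate_vertex_def)
  ultimately show ?case
    using H Suc.hyps duplicate_vertex_pair_graph[of H v' v] by simp
qed

lemma is_Rtilde_pair_graph:
  assumes "is_Rtilde n G"
  shows "pair_graph G" "card (pverts G) = n + 5"
proof -
  from assms obtain C v' where C: "cycle_graph 5 C" and v': "v' \<in> pverts C"
    and G: "duplicated_times C v' n G" by (auto simp: is_Rtilde_def)
  from duplicated_times_pair_graph[OF G cycle_graph_pair_graph(1)[OF C] v']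
  show "pair_graph G" "card (pverts G) = n + 5"
    using cycle_graph_pair_graph(2)[OF C] by simp_all
qed

lemma is_Rtilde_exists: "\<exists>G :: nat pair_pre_digraph. is_Rtilde n G"
proof -
  define C :: "nat pair_pre_digraph" where
    "C = \<lparr> pverts = set [0..<5],
      parcs = (\<Union>i<5. {([0..<5] ! i, [0..<5] ! ((i + 1) mod 5)), ([0..<5] ! ((i + 1) mod 5), [0..<5] ! i)}) \<rparr>"
  have C: "cycle_graph 5 C"
    unfolding cycle_graph_def by (intro conjI exI[of _ "[0..<5]"]) (simp_all add: C_def)
  have 0: "0 \<in> pverts C" by (simp add: C_def)
  have "\<exists>H. duplicated_times C 0 n H"
  proof (induction n)
    case 0
    show ?case by (blast intro: duplicated_times.zero)
  next
    case (Suc n)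
    then obtain H where H: "duplicated_times C 0 n H" by blast
    then have "pair_graph H"
      using duplicated_times_pair_graph[OF H cycle_graph_pair_graph(1)[OF C] 0] by blast
    then have "finite (pverts H)" by (simp add: pair_graph_iff)
    then obtain v where "v \<notin> pverts H" using ex_new_if_finite infinite_UNIV_nat by blast
    with H show ?case by (blast intro: duplicated_times.Suc)
  qed
  with C 0 show ?thesis by (auto simp: is_Rtilde_def)
qed

end

theory Submission
  imports Defs
begin

text \<open>
  Duplicating a vertex \<open>v'\<close> produces a vertex with the same closed neighbourhood as \<open>v'\<close>. Hence
  the vertices of an iterated duplicate of the 5-cycle fall into five classes of mutually adjacent
  vertices, one of size \<open>n + 1\<close> and four singletons, and whether two distinct vertices are adjacent
  depends on their classes only, through the adjacent-or-equal relation of the 5-cycle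
  (\<open>clique_blowup\<close>, \<open>is_Rtilde_clique_blowup\<close>).

  So if \<open>U\<close> is the \<open>5 \<times> (n + 5)\<close> indicator matrix of the classes and \<open>M\<close> the matrix of the
  adjacent-or-equal relation, then \<open>A + I = U\<^sup>T M U\<close>, in whatever order the vertices are listed.
  Sylvester's determinant identity (\<open>det_smult_one_minus_mult_commute\<close>), applied over the
  polynomial ring with \<open>y = x + 1\<close>, gives
  \<open>y\<^sup>5 det (y I - U\<^sup>T M U) = y\<^bsup>n+5\<^esup> det (y I - M U U\<^sup>T)\<close>, whose left-hand determinant is \<open>\<phi>(A, x)\<close>.
  As \<open>U U\<^sup>T\<close> is the diagonal matrix of the class sizes \<open>n + 1, 1, 1, 1, 1\<close>, the determinant on the
  right is \<open>5 \<times> 5\<close> and is computed by expansion (\<open>det_cycle5_quotient\<close>). Cancelling \<open>y\<^sup>5\<close> leaves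
  the factor \<open>y\<^sup>n\<close> and this quintic.
\<close>

section \<open>Sylvester's determinant identity\<close>

text \<open>
  The block matrix with rows \<open>(y I, P)\<close> and \<open>(Q, I)\<close> can be made block triangular in two ways:
  clearing \<open>Q\<close> from the right gives the determinant of \<open>y I - P Q\<close>, and clearing it from the
  left, at the cost of scaling the last \<open>k\<close> rows by \<open>y\<close>, gives that of \<open>y I - Q P\<close>.
\<close>

lemma det_smult_one_minus_mult_commute:
  fixes P Q :: "'a :: idom mat"
  assumes P: "P \<in> carrier_mat n k" and Q: "Q \<in> carrier_mat k n"
  shows "y ^ k * det (y \<cdot>\<^sub>m 1\<^sub>m n - P * Q) = y ^ n * det (y \<cdot>\<^sub>m 1\<^sub>m k - Q * P)"
proof -
  let ?M = "four_block_mat (y \<cdot>\<^sub>m 1\<^sub>m n) P Q (1\<^sub>m k)"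
  let ?R = "four_block_mat (1\<^sub>m n) (0\<^sub>m n k) (- Q) (1\<^sub>m k)"
  let ?L = "four_block_mat (1\<^sub>m n) (0\<^sub>m n k) (- Q) (y \<cdot>\<^sub>m 1\<^sub>m k)"
  have M: "?M \<in> carrier_mat (n + k) (n + k)" and R: "?R \<in> carrier_mat (n + k) (n + k)"
    and L: "?L \<in> carrier_mat (n + k) (n + k)"
    using P Q by auto
  have PQ: "y \<cdot>\<^sub>m 1\<^sub>m n - P * Q \<in> carrier_mat n n"
    and QP: "y \<cdot>\<^sub>m 1\<^sub>m k - Q * P \<in> carrier_mat k k"
    using mult_carrier_mat[OF P Q] mult_carrier_mat[OF Q P] by (simp_all add: minus_carrier_mat)
  have "?M * ?R = four_block_mat (y \<cdot>\<^sub>m 1\<^sub>m n * 1\<^sub>m n + P * (- Q)) (y \<cdot>\<^sub>m 1\<^sub>m n * 0\<^sub>m n k + P * 1\<^sub>m k)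
      (Q * 1\<^sub>m n + 1\<^sub>m k * (- Q)) (Q * 0\<^sub>m n k + 1\<^sub>m k * 1\<^sub>m k)"
    by (rule mult_four_block_mat) (use P Q in auto)
  also have "\<dots> = four_block_mat (y \<cdot>\<^sub>m 1\<^sub>m n - P * Q) P (0\<^sub>m k n) (1\<^sub>m k)"
    by (rule arg_cong4[of _ _ _ _ _ _ _ _ four_block_mat]) (use P Q in \<open>auto intro!: eq_matI\<close>)
  finally have "det (?M * ?R) = det (y \<cdot>\<^sub>m 1\<^sub>m n - P * Q) * det (1\<^sub>m k :: 'a mat)"
    using det_four_block_mat_lower_left_zero[of "y \<cdot>\<^sub>m 1\<^sub>m n - P * Q" n P k "0\<^sub>m k n" "1\<^sub>m k"] P PQ
    by simp
  moreover have "det ?R = 1"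
    using det_four_block_mat_upper_right_zero[of "1\<^sub>m n" n "0\<^sub>m n k" k "- Q" "1\<^sub>m k"] Q by simp
  ultimately have det_M: "det ?M = det (y \<cdot>\<^sub>m 1\<^sub>m n - P * Q)"
    using det_mult[OF M R] by simp
  have "?L * ?M = four_block_mat (1\<^sub>m n * (y \<cdot>\<^sub>m 1\<^sub>m n) + 0\<^sub>m n k * Q) (1\<^sub>m n * P + 0\<^sub>m n k * 1\<^sub>m k)
      (- Q * (y \<cdot>\<^sub>m 1\<^sub>m n) + y \<cdot>\<^sub>m 1\<^sub>m k * Q) (- Q * P + y \<cdot>\<^sub>m 1\<^sub>m k * 1\<^sub>m k)"
    by (rule mult_four_block_mat) (use P Q in auto)
  also have "\<dots> = four_block_mat (y \<cdot>\<^sub>m 1\<^sub>m n) P (0\<^sub>m k n) (y \<cdot>\<^sub>m 1\<^sub>m k - Q * P)"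
    by (rule arg_cong4[of _ _ _ _ _ _ _ _ four_block_mat]) (use P Q in \<open>auto intro!: eq_matI\<close>)
  finally have "det (?L * ?M) = y ^ n * det (y \<cdot>\<^sub>m 1\<^sub>m k - Q * P)"
    using det_four_block_mat_lower_left_zero[of "y \<cdot>\<^sub>m 1\<^sub>m n" n P k "0\<^sub>m k n" "y \<cdot>\<^sub>m 1\<^sub>m k - Q * P"] P QP
    by simp
  moreover have "det ?L = y ^ k"
    using det_four_block_mat_upper_right_zero[of "1\<^sub>m n" n "0\<^sub>m n k" k "- Q" "y \<cdot>\<^sub>m 1\<^sub>m k"] Q by simp
  ultimately show ?thesis
    using det_mult[OF L M] det_M by simp
qed

section \<open>Clique blow-ups\<close>

text \<open>
  A relation \<open>r\<close> on \<open>{..<k}\<close> is blown up by replacing each \<open>i < k\<close> with the clique of the vertices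
  \<open>v\<close> with \<open>c v = i\<close>. The pairs \<open>(i, i)\<close> of \<open>r\<close> record that a class is a clique, so that \<open>r\<close> is an
  adjacent-or-equal relation rather than an adjacency relation.
\<close>

definition clique_blowup ::
    "(nat \<Rightarrow> nat \<Rightarrow> bool) \<Rightarrow> nat \<Rightarrow> ('a \<Rightarrow> nat) \<Rightarrow> 'a pair_pre_digraph \<Rightarrow> bool" where
  "clique_blowup r k c G \<longleftrightarrow> finite (pverts G) \<and> (\<forall>i<k. r i i) \<and> symp r \<and>
     c ` pverts G \<subseteq> {..<k} \<and>
     parcs G = {(u, w). u \<in> pverts G \<and> w \<in> pverts G \<and> u \<noteq> w \<and> r (c u) (c w)}"

text \<open>
  Since the closed neighbourhood of \<open>v'\<close> consists of the vertices whose class is related to that of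
  \<open>v'\<close>, a duplicate of \<open>v'\<close> simply joins the class of \<open>v'\<close>.
\<close>

lemma clique_blowup_duplicate_vertex:
  assumes "clique_blowup r k c G" "v' \<in> pverts G" "v \<notin> pverts G"
  shows "clique_blowup r k (c(v := c v')) (duplicate_vertex G v' v)"
proof -
  from assms have fin: "finite (pverts G)" and refl: "\<And>i. i < k \<Longrightarrow> r i i" and r: "symp r"
    and c: "c ` pverts G \<subseteq> {..<k}"
    and arcs: "\<And>u w. (u, w) \<in> parcs G \<longleftrightarrow>
      u \<in> pverts G \<and> w \<in> pverts G \<and> u \<noteq> w \<and> r (c u) (c w)"
    by (auto simp: clique_blowup_def)
  have sym: "r i j \<longleftrightarrow> r j i" for i j
    using r by (meson sympD)
  have "r (c v') (c v')"
    using refl c assms(2) by blast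
  then have "(u, w) \<in> parcs (duplicate_vertex G v' v) \<longleftrightarrow>
      u \<in> insert v (pverts G) \<and> w \<in> insert v (pverts G) \<and> u \<noteq> w \<and>
        r ((c(v := c v')) u) ((c(v := c v')) w)" for u w
    using assms(2,3) unfolding duplicate_vertex_def
    by (cases "u = v"; cases "w = v") (auto simp: arcs sym)
  then have "parcs (duplicate_vertex G v' v) = {(u, w). u \<in> insert v (pverts G) \<and>
      w \<in> insert v (pverts G) \<and> u \<noteq> w \<and> r ((c(v := c v')) u) ((c(v := c v')) w)}"
    by (simp add: set_eq_iff)
  moreover have "(c(v := c v')) ` insert v (pverts G) \<subseteq> {..<k}"
    using c assms(2) by auto
  ultimately show ?thesis
    using fin refl r by (simp add: clique_blowup_def duplicate_vertex_def)
qed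

lemma card_class_duplicate_vertex:
  assumes "finite (pverts G)" "v \<notin> pverts G"
  shows "card {u \<in> pverts (duplicate_vertex G v' v). (c(v := c v')) u = i} =
    card {u \<in> pverts G. c u = i} + (if i = c v' then 1 else 0)"
proof -
  have "{u \<in> pverts (duplicate_vertex G v' v). (c(v := c v')) u = i} =
      (if i = c v' then insert v {u \<in> pverts G. c u = i} else {u \<in> pverts G. c u = i})"
    using assms(2) by (auto simp: duplicate_vertex_def)
  then show ?thesis using assms by simp
qed

lemma clique_blowup_duplicated_times:
  assumes "duplicated_times G v' n H" "clique_blowup r k c G" "v' \<in> pverts G"
  shows "\<exists>c'. clique_blowup r k c' H \<and> v' \<in> pverts H \<and> c' v' = c v' \<and>
    (\<forall>i. card {u \<in> pverts H. c' u = i} =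
       card {u \<in> pverts G. c u = i} + (if i = c v' then n else 0))"
  using assms
proof (induction rule: duplicated_times.induct)
  case zero
  then show ?case by (intro exI[of _ c]) simp
next
  case (Suc n H v)
  then obtain c' where c': "clique_blowup r k c' H" "v' \<in> pverts H" "c' v' = c v'"
    and cards: "\<And>i. card {u \<in> pverts H. c' u = i} =
      card {u \<in> pverts G. c u = i} + (if i = c v' then n else 0)"
    by blast
  have "finite (pverts H)" using c'(1) by (simp add: clique_blowup_def)
  moreover have "v' \<noteq> v" using c'(2) Suc.hyps by blast
  moreover have "v' \<in> pverts (duplicate_vertex H v' v)"
    using c'(2) by (simp add: duplicate_vertex_def)
  ultimately show ?case
    using clique_blowup_duplicate_vertex[OF c'(1,2) Suc.hyps(2)] c'(3) cards
      card_class_duplicate_vertex[of H v v' c'] Suc.hyps(2)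
    by (intro exI[of _ "c'(v := c' v')"]) (auto simp: fun_upd_def)
qed

text \<open>
  With \<open>U\<close> the indicator matrix of the classes and \<open>M\<close> the matrix of \<open>r\<close>, this is Sylvester's
  identity for \<open>P = U\<^sup>T\<close> and \<open>Q = M U\<close>: the product \<open>P Q\<close> is \<open>A + I\<close>, and column \<open>j\<close> of \<open>Q P\<close> is
  column \<open>j\<close> of \<open>M\<close> times the size of class \<open>j\<close>. It relates \<open>A\<close> to its quotient matrix without
  naming an order of the vertices in which the classes are consecutive.
\<close>

lemma char_poly_clique_blowup:
  fixes G :: "'a pair_pre_digraph" and vs :: "'a list"
  assumes G: "clique_blowup r k c G" and vs: "distinct vs" "set vs = pverts G"
  shows "[:1, 1:] ^ k * char_poly (adjacency_matrix G vs :: 'b :: idom mat) =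
    [:1, 1:] ^ length vs * det (mat k k (\<lambda>(i, j). (if i = j then [:1, 1:] else 0)
      - (if r i j then of_nat (card {v \<in> pverts G. c v = j}) else 0)))"
proof -
  let ?N = "length vs" and ?y = "[:1, 1:] :: 'b poly"
  define P :: "'b poly mat" where "P = mat ?N k (\<lambda>(a, i). if c (vs ! a) = i then 1 else 0)"
  define Q :: "'b poly mat" where "Q = mat k ?N (\<lambda>(i, a). if r i (c (vs ! a)) then 1 else 0)"
  have P: "P \<in> carrier_mat ?N k" and Q: "Q \<in> carrier_mat k ?N"
    by (auto simp: P_def Q_def)
  have class_less: "c (vs ! a) < k" if "a < ?N" for a
    using G vs(2) nth_mem[OF that] by (auto simp: clique_blowup_def)
  have PQ: "(P * Q) $$ (a, b) = (if r (c (vs ! a)) (c (vs ! b)) then 1 else 0)"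
    if "a < ?N" "b < ?N" for a b
  proof -
    have "(P * Q) $$ (a, b) =
        (\<Sum>i<k. (if c (vs ! a) = i then 1 else 0) * (if r i (c (vs ! b)) then 1 else 0))"
      using that by (simp add: P_def Q_def scalar_prod_def lessThan_atLeast0)
    also have "\<dots> = (\<Sum>i<k. if i = c (vs ! a) then if r i (c (vs ! b)) then 1 else 0 else 0)"
      by (rule sum.cong) auto
    finally show ?thesis using class_less[OF that(1)] by simp
  qed
  have "char_poly_matrix (adjacency_matrix G vs :: 'b mat) = ?y \<cdot>\<^sub>m 1\<^sub>m ?N - P * Q"
  proof (rule eq_matI)
    fix a b
    assume "a < dim_row (?y \<cdot>\<^sub>m 1\<^sub>m ?N - P * Q)" "b < dim_col (?y \<cdot>\<^sub>m 1\<^sub>m ?N - P * Q)"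
    then have ab: "a < ?N" "b < ?N" using P Q by auto
    have "(vs ! a, vs ! b) \<in> parcs G \<longleftrightarrow> a \<noteq> b \<and> r (c (vs ! a)) (c (vs ! b))"
      using G vs ab nth_mem[of a vs] nth_mem[of b vs]
      by (auto simp: clique_blowup_def nth_eq_iff_index_eq)
    moreover have "r (c (vs ! a)) (c (vs ! a))"
      using G class_less[OF ab(1)] by (simp add: clique_blowup_def)
    moreover have "(?y \<cdot>\<^sub>m 1\<^sub>m ?N - P * Q) $$ (a, b) =
        (if a = b then ?y else 0) - (if r (c (vs ! a)) (c (vs ! b)) then 1 else 0)"
      using PQ[OF ab] ab P Q by (simp add: one_pCons del: index_mult_mat(1))
    ultimately show "char_poly_matrix (adjacency_matrix G vs) $$ (a, b) =
        (?y \<cdot>\<^sub>m 1\<^sub>m ?N - P * Q) $$ (a, b)"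
      using ab by (auto simp: char_poly_matrix_def adjacency_matrix_def one_pCons)
  qed (use P Q in \<open>auto simp: char_poly_matrix_def adjacency_matrix_def\<close>)
  moreover have QP: "(Q * P) $$ (i, j) = (if r i j then of_nat (card {v \<in> pverts G. c v = j}) else 0)"
    if "i < k" "j < k" for i j
  proof -
    have "(Q * P) $$ (i, j) =
        (\<Sum>a<?N. (if r i (c (vs ! a)) then 1 else 0) * (if c (vs ! a) = j then 1 else 0))"
      using that by (simp add: P_def Q_def scalar_prod_def lessThan_atLeast0)
    also have "\<dots> = (\<Sum>a<?N. if c (vs ! a) = j then if r i j then 1 else 0 else 0)"
      by (rule sum.cong) auto
    also have "\<dots> = (\<Sum>v\<in>pverts G. if c v = j then if r i j then 1 else 0 else 0)"
      using bij_betw_nth[OF vs(1) refl vs(2)[symmetric]]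
      by (rule sum.reindex_bij_betw[where h = "nth vs"])
    also have "\<dots> = (if r i j then of_nat (card {v \<in> pverts G. c v = j}) else 0)"
      using G by (simp add: clique_blowup_def sum.If_cases Int_def flip: sum.inter_filter)
    finally show ?thesis .
  qed
  have "?y \<cdot>\<^sub>m 1\<^sub>m k - Q * P = mat k k (\<lambda>(i, j). (if i = j then ?y else 0)
      - (if r i j then of_nat (card {v \<in> pverts G. c v = j}) else 0))"
    by (rule eq_matI) (use P Q QP in \<open>auto simp: one_pCons simp del: index_mult_mat(1)\<close>)
  ultimately show ?thesis
    using det_smult_one_minus_mult_commute[OF P Q, of ?y] by (simp add: char_poly_def)
qed

section \<open>Cycles and their iterated duplicates\<close>

definition cycle_adjacent_or_eq :: "nat \<Rightarrow> nat \<Rightarrow> nat \<Rightarrow> bool" where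
  "cycle_adjacent_or_eq k i j \<longleftrightarrow> i = j \<or> j = (i + 1) mod k \<or> i = (j + 1) mod k"

text \<open>By rotating a cyclic enumeration, a cycle can be traversed from any of its vertices.\<close>

lemma cycle_graph_start_at:
  assumes "cycle_graph k G" "v \<in> pverts G"
  obtains vs where "length vs = k" "distinct vs" "pverts G = set vs" "vs ! 0 = v"
    "parcs G = (\<Union>i<k. {(vs ! i, vs ! ((i + 1) mod k)), (vs ! ((i + 1) mod k), vs ! i)})"
proof -
  from assms obtain us where k: "k \<ge> 3" and us: "length us = k" "distinct us" "pverts G = set us"
    and arcs: "parcs G = (\<Union>i<k. {(us ! i, us ! ((i + 1) mod k)), (us ! ((i + 1) mod k), us ! i)})"
    by (auto simp: cycle_graph_def)
  obtain p where p: "p < k" "us ! p = v"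
    using assms(2) us by (auto simp: in_set_conv_nth)
  let ?s = "\<lambda>i. (p + i) mod k"
  have nth: "rotate p us ! i = us ! ?s i" if "i < k" for i
    using that us(1) nth_rotate by metis
  have nth_next: "rotate p us ! ((i + 1) mod k) = us ! ((?s i + 1) mod k)" for i
  proof -
    have "?s ((i + 1) mod k) = (?s i + 1) mod k"
      by (simp add: mod_simps)
    moreover have "(i + 1) mod k < k" using k by simp
    ultimately show ?thesis using nth by metis
  qed
  have surj: "?s ` {..<k} = {..<k}"
  proof
    show "{..<k} \<subseteq> ?s ` {..<k}"
    proof
      fix i assume "i \<in> {..<k}"
      then have "?s ((i + (k - p)) mod k) = i"
        using p(1) by (simp add: mod_simps)
      moreover have "(i + (k - p)) mod k < k" using k by simp
      ultimately show "i \<in> ?s ` {..<k}" by (metis imageI lessThan_iff)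
    qed
  qed (use k in auto)
  show thesis
  proof (rule that[of "rotate p us"])
    show "rotate p us ! 0 = v" using nth[of 0] k p by simp
    have "parcs G = (\<Union>i\<in>?s ` {..<k}. {(us ! i, us ! ((i + 1) mod k)), (us ! ((i + 1) mod k), us ! i)})"
      unfolding surj arcs ..
    also have "\<dots> = (\<Union>i<k. {(rotate p us ! i, rotate p us ! ((i + 1) mod k)),
        (rotate p us ! ((i + 1) mod k), rotate p us ! i)})"
      unfolding nth_next image_image by (intro SUP_cong) (auto simp: nth)
    finally show "parcs G = \<dots>" .
  qed (use us in auto)
qed

text \<open>
  Every cycle is its own blow-up with singleton classes, the class of a vertex being its position
  in a traversal. Starting at the vertex to be duplicated puts that vertex into class \<open>0\<close>.
\<close>

lemma cycle_graph_clique_blowup: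
  assumes "cycle_graph k G" "v \<in> pverts G"
  obtains c where "clique_blowup (cycle_adjacent_or_eq k) k c G" "c v = 0"
    "\<And>i. i < k \<Longrightarrow> card {u \<in> pverts G. c u = i} = 1"
proof -
  from assms(1) have k: "k \<ge> 3" by (simp add: cycle_graph_def)
  from cycle_graph_start_at[OF assms] obtain vs where vs: "length vs = k" "distinct vs"
      "pverts G = set vs" "vs ! 0 = v"
    and arcs: "parcs G = (\<Union>i<k. {(vs ! i, vs ! ((i + 1) mod k)), (vs ! ((i + 1) mod k), vs ! i)})"
    by blast
  define c where "c = the_inv_into {..<k} (nth vs)"
  have inj: "inj_on (nth vs) {..<k}"
    using vs(1,2) by (auto simp: inj_on_def nth_eq_iff_index_eq)
  have c: "c (vs ! i) = i" if "i < k" for i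
    using the_inv_into_f_f[OF inj] that by (simp add: c_def)
  have verts: "pverts G = nth vs ` {..<k}"
    using vs(1,3) nth_image[of k vs] by (simp add: lessThan_atLeast0)
  have next_ne: "(i + 1) mod k \<noteq> i" if "i < k" for i
    using that k by (cases "i + 1 = k") auto
  show thesis
  proof (rule that[of c])
    have "((u, w) \<in> parcs G) \<longleftrightarrow> u \<in> pverts G \<and> w \<in> pverts G \<and> u \<noteq> w \<and>
        cycle_adjacent_or_eq k (c u) (c w)" (is "?l \<longleftrightarrow> ?r") for u w
    proof
      assume ?l
      then obtain i where i: "i < k"
        and uw: "u = vs ! i \<and> w = vs ! ((i + 1) mod k) \<or> u = vs ! ((i + 1) mod k) \<and> w = vs ! i"
        unfolding arcs by blast
      have j: "(i + 1) mod k < k" using k by simp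
      show ?r
        using uw c[OF i] c[OF j] i j next_ne[OF i] unfolding verts cycle_adjacent_or_eq_def
        by (metis imageI lessThan_iff)
    next
      assume ?r
      then show ?l
        unfolding arcs verts cycle_adjacent_or_eq_def using c by (auto simp del: One_nat_def)
    qed
    then have "parcs G = {(u, w). u \<in> pverts G \<and> w \<in> pverts G \<and> u \<noteq> w \<and>
        cycle_adjacent_or_eq k (c u) (c w)}"
      by auto
    moreover have "symp (cycle_adjacent_or_eq k)"
      by (auto simp: symp_def cycle_adjacent_or_eq_def)
    moreover have "c ` pverts G \<subseteq> {..<k}" using c verts by auto
    ultimately show "clique_blowup (cycle_adjacent_or_eq k) k c G"
      using vs(3) by (simp add: clique_blowup_def cycle_adjacent_or_eq_def)
    show "c v = 0" using c[of 0] vs(4) k by simp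
    fix i assume i: "i < k"
    then have "{u \<in> pverts G. c u = i} = {vs ! i}" using c verts by auto
    then show "card {u \<in> pverts G. c u = i} = 1" by simp
  qed
qed

lemma is_Rtilde_clique_blowup:
  assumes "is_Rtilde n G"
  obtains c where "clique_blowup (cycle_adjacent_or_eq 5) 5 c G"
    "\<And>i. i < 5 \<Longrightarrow> card {u \<in> pverts G. c u = i} = (if i = 0 then n + 1 else 1)"
proof -
  from assms obtain C v' where C: "cycle_graph 5 C" and v': "v' \<in> pverts C"
    and G: "duplicated_times C v' n G" by (auto simp: is_Rtilde_def)
  from cycle_graph_clique_blowup[OF C v'] obtain c0
    where "clique_blowup (cycle_adjacent_or_eq 5) 5 c0 C" "c0 v' = 0"
      "\<And>i. i < 5 \<Longrightarrow> card {u \<in> pverts C. c0 u = i} = 1" by blast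
  with clique_blowup_duplicated_times[OF G this(1) v'] that show thesis by auto
qed

section \<open>The quotient determinant\<close>

text \<open>
  Laplace expansion in a form that maps a matrix given by a function of its indices to smaller
  matrices of that kind, so that rewriting with it evaluates a determinant of numeral size.
\<close>

lemma det_mat_Suc:
  fixes f :: "nat \<times> nat \<Rightarrow> 'a :: comm_ring_1"
  shows "det (mat (Suc n) (Suc n) f) = (\<Sum>j<Suc n. (-1) ^ j * f (0, j) *
    det (mat n n (\<lambda>(a, b). f (Suc a, if b < j then b else Suc b))))"
proof -
  have "mat_delete (mat (Suc n) (Suc n) f) 0 j =
      mat n n (\<lambda>(a, b). f (Suc a, if b < j then b else Suc b))" for j
    by (rule eq_matI) (auto simp: mat_delete_def)
  then show ?thesis
    by (subst laplace_expansion_row[of _ "Suc n" 0])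
      (auto simp: cofactor_def mult_ac intro!: sum.cong)
qed

text \<open>
  As congruence rules, these keep the simplifier out of the summand and of the entry function, so
  that entries are evaluated only at concrete indices, once the sums have been unfolded.
\<close>

lemma sum_weak_cong: "A = B \<Longrightarrow> sum f A = sum f B"
  by simp

lemma mat_weak_cong: "m = m' \<Longrightarrow> n = n' \<Longrightarrow> mat m n f = mat m' n' f"
  by simp

text \<open>
  Here \<open>m\<close> stands for the size of class \<open>0\<close>. The two factors come from the reflection of the cycle
  that fixes \<open>0\<close> and swaps \<open>1\<close> with \<open>4\<close> and \<open>2\<close> with \<open>3\<close>: the quadratic is the contribution of the
  antisymmetric vectors, which vanish at \<open>0\<close> and so do not see \<open>m\<close>, and the cubic is that of the
  symmetric ones. Expanding the determinant confirms this product.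
\<close>

lemma det_cycle5_quotient:
  fixes x m :: "'a :: comm_ring_1"
  shows "det (mat 5 5 (\<lambda>(i, j). (if i = j then x + 1 else 0)
      - (if cycle_adjacent_or_eq 5 i j then if j = 0 then m else 1 else 0))) =
    (x ^ 3 - m * x ^ 2 - (m + 2) * x + (3 * m - 1)) * (x ^ 2 + x - 1)"
    (is "det (mat 5 5 ?f) = ?d")
proof -
  define rows where "rows =
    [[x + 1 - m, -1,  0,  0, -1],
     [-m,         x, -1,  0,  0],
     [0,         -1,  x, -1,  0],
     [0,          0, -1,  x, -1],
     [-m,         0,  0, -1,  x]]"
  have less_5: "i < 5 \<longleftrightarrow> i = 0 \<or> i = 1 \<or> i = 2 \<or> i = 3 \<or> i = 4" for i :: nat
    by auto
  have "?f (i, j) = rows ! i ! j" if "i < 5" "j < 5" for i j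
    using that unfolding less_5
    by (elim disjE; simp add: cycle_adjacent_or_eq_def rows_def)
  then have "mat 5 5 ?f = mat 5 5 (\<lambda>(i, j). rows ! i ! j)"
    by (intro eq_matI) simp_all
  \<comment> \<open>the size in the form to which the Laplace expansion applies\<close>
  also have "\<dots> = mat (Suc (Suc (Suc (Suc (Suc 0))))) (Suc (Suc (Suc (Suc (Suc 0)))))
      (\<lambda>(i, j). rows ! i ! j)"
    by (rule cong_mat) simp_all
  finally show ?thesis
    unfolding rows_def
    by (simp only: det_mat_Suc det_dim_zero mat_carrier sum.lessThan_Suc lessThan_0 sum.empty
        case_prod_conv nth_Cons_0 nth_Cons_Suc Suc_less_eq not_less0 zero_less_Suc if_True if_False
        power_0 power_Suc mult_zero_left mult_zero_right mult_1_left mult_1_right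
        add_0_left add_0_right mult_minus_left mult_minus_right minus_minus minus_zero
        cong: sum_weak_cong mat_weak_cong)
      (simp add: power2_eq_square power3_eq_cube algebra_simps)
qed

theorem theorem4p8:
  fixes n :: nat and G :: "'a pair_pre_digraph" and vs :: "'a list"
  assumes "is_Rtilde n G"
    and "distinct vs" and "set vs = pverts G"
  shows "char_poly (adjacency_matrix G vs :: real mat) =
    [: 3 * real n + 2, - (real n + 3), - (real n + 1), 1 :] * [: 1, 1 :] ^ n * [: - 1, 1, 1 :]"
proof -
  let ?y = "[:1, 1:] :: real poly"
  obtain c where c: "clique_blowup (cycle_adjacent_or_eq 5) 5 c G"
    and cards: "\<And>i. i < 5 \<Longrightarrow> card {u \<in> pverts G. c u = i} = (if i = 0 then n + 1 else 1)"
    using is_Rtilde_clique_blowup[OF assms(1)] by blast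
  define x m :: "real poly" where "x = [:0, 1:]" and "m = of_nat (n + 1)"
  have y: "?y = x + 1" by (simp add: x_def one_pCons)
  have m: "m = [:real n + 1:]" by (simp add: m_def of_nat_poly one_pCons)
  have "length vs = n + 5"
    using is_Rtilde_pair_graph(2)[OF assms(1)] assms(2,3) distinct_card by metis
  then have "?y ^ 5 * char_poly (adjacency_matrix G vs :: real mat) = ?y ^ (n + 5) *
      det (mat 5 5 (\<lambda>(i, j). (if i = j then x + 1 else 0)
        - (if cycle_adjacent_or_eq 5 i j then of_nat (card {v \<in> pverts G. c v = j}) else 0)))"
    using char_poly_clique_blowup[OF c assms(2,3), where ?'b = real] unfolding y by simp
  also have "mat 5 5 (\<lambda>(i, j). (if i = j then x + 1 else 0)
        - (if cycle_adjacent_or_eq 5 i j then of_nat (card {v \<in> pverts G. c v = j}) else 0)) =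
      mat 5 5 (\<lambda>(i, j). (if i = j then x + 1 else 0)
        - (if cycle_adjacent_or_eq 5 i j then if j = 0 then m else 1 else 0))"
    by (rule eq_matI) (auto simp: cards m_def)
  also note det_cycle5_quotient
  also have "x ^ 3 - m * x ^ 2 - (m + 2) * x + (3 * m - 1) =
      [: 3 * real n + 2, - (real n + 3), - (real n + 1), 1 :]"
    by (simp add: m x_def eval_nat_numeral numeral_poly one_pCons)
  also have "x ^ 2 + x - 1 = [: - 1, 1, 1 :]"
    by (simp add: x_def power2_eq_square one_pCons)
  also have "?y ^ (n + 5) * ([: 3 * real n + 2, - (real n + 3), - (real n + 1), 1 :] * [: - 1, 1, 1 :]) =
      ?y ^ 5 * ([: 3 * real n + 2, - (real n + 3), - (real n + 1), 1 :] * ?y ^ n * [: - 1, 1, 1 :])"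
    unfolding power_add by (simp only: mult_ac)
  finally show ?thesis
    by (subst (asm) mult_left_cancel) simp_all
qed

end
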